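(* Let $\mathcal{A}$ be a (randomized) algorithm that solves the wake-up problem with high probability in $f(n)$ rounds in the radio network model with a single channel and collision detection (that is, for every network size $n$ and every non-empty set of activated nodes, the problem is solved within $f(n)$ rounds with probability at least $1-\frac1n$). Then $f(n)\in\Omega(\log n)$.
   Context: Radio network model (single hop, single channel, with collision detection): there are $n$ nodes with unique ids from $[n]=\{1,\dots,n\}$, every two of which are neighbors. Executions proceed in synchronous rounds. In each round each node either transmits a message or receives. A node $u$ receives a message from $v$ in a round if and only if $u$ is receiving, $v$ is transmitting, and $v$ is the only neighbor of $u$ transmitting in that round. Collision detection: a receiving node can distinguish between silence (no neighbor transmits) and collision (two or more neighbors transmit); moreover a transmitting node can distinguish between transmitting alone and transmitting simultaneously with one or more other nodes. Wake-up problem: all nodes are initially inactive; at the beginning of the execution an adversary activates an arbitrary non-empty subset of the nodes. Inactive nodes can only listen (detecting a collision does not wake them up); active nodes execute an arbitrary randomized algorithm and have no advance knowledge of the identities of the other active nodes. The problem is solved in the first round in which exactly one active node transmits (an active node broadcasts alone). Asymptotics are as $n\to\infty$. *)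

theory Defs
  imports "HOL-Probability.Probability" "HOL-Library.Landau_Symbols"
begin

datatype 'm action = Transmit 'm | Listen

abbreviation transmits :: "'m action \<Rightarrow> bool" where
  "transmits a \<equiv> a \<noteq> Listen"

text \<open>What a node learns in one round. The first three outcomes are for receiving nodes, the last
  two for transmitting nodes.\<close>

datatype 'm feedback = Silence | Received 'm | Collision | SentAlone | SentTogether

text \<open>Single hop: every two of the nodes \<open>1, \<dots>, n\<close> are neighbours.\<close>

definition neighbors :: "nat \<Rightarrow> nat \<Rightarrow> nat set" where
  "neighbors n u = {1..n} - {u}"

definition feedback_of :: "nat \<Rightarrow> (nat \<Rightarrow> 'm action) \<Rightarrow> nat \<Rightarrow> 'm feedback" where
  "feedback_of n a u =
     (let T = {v \<in> neighbors n u. transmits (a v)} in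
      if transmits (a u) then (if T = {} then SentAlone else SentTogether)
      else if T = {} then Silence
      else if card T = 1 then (case a (the_elem T) of Transmit m \<Rightarrow> Received m)
      else Collision)"

text \<open>A randomized algorithm gives, for every network size \<open>n\<close> and every node id \<open>i\<close>, the distribution
  \<open>coins A n i\<close> of the private random source of \<open>i\<close> and a decision rule: \<open>act A n i c h\<close> is what \<open>i\<close>,
  if active, does after having observed the feedback \<open>h\<close> (oldest first) in the previous rounds, when
  its random source has the value \<open>c\<close>. The own past actions of a node are determined by
  \<open>c\<close> and \<open>h\<close>, so they need not be arguments. The set of active nodes is not an argument either:
  nothing is known about it in advance.\<close>

record ('c, 'm) algorithm =
  coins :: "nat \<Rightarrow> nat \<Rightarrow> 'c measure"
  act :: "nat \<Rightarrow> nat \<Rightarrow> 'c \<Rightarrow> 'm feedback list \<Rightarrow> 'm action"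

text \<open>Only the decision whether to transmit has to be measurable: until a node transmits alone no
  message is received, so only finitely many histories are possible and the contents of the
  messages have no influence on the event that the wake-up problem is solved.\<close>

definition randomized_algorithm :: "('c, 'm) algorithm \<Rightarrow> bool" where
  "randomized_algorithm A \<longleftrightarrow>
     (\<forall>n. \<forall>i\<in>{1..n}. prob_space (coins A n i) \<and>
        (\<forall>h. {c \<in> space (coins A n i). transmits (act A n i c h)} \<in> sets (coins A n i)))"

definition node_action ::
  "('c, 'm) algorithm \<Rightarrow> nat \<Rightarrow> nat set \<Rightarrow> (nat \<Rightarrow> 'c) \<Rightarrow> (nat \<Rightarrow> 'm feedback list) \<Rightarrow> nat \<Rightarrow> 'm action"
where
  "node_action A n S \<omega> h u = (if u \<in> S then act A n u (\<omega> u) (h u) else Listen)"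

text \<open>The execution with active set \<open>S\<close> in which the random source of node \<open>u\<close> has the value \<open>\<omega> u\<close>:
  \<open>history A n S \<omega> r u\<close> is the feedback observed by \<open>u\<close> in the first \<open>r\<close> rounds. Inactive nodes
  listen throughout; whether receiving a message would activate them is immaterial, as
  the problem is already solved when the first message is received.\<close>

primrec history ::
  "('c, 'm) algorithm \<Rightarrow> nat \<Rightarrow> nat set \<Rightarrow> (nat \<Rightarrow> 'c) \<Rightarrow> nat \<Rightarrow> nat \<Rightarrow> 'm feedback list"
where
  "history A n S \<omega> 0 = (\<lambda>u. [])"
| "history A n S \<omega> (Suc r) =
     (\<lambda>u. history A n S \<omega> r u @ [feedback_of n (node_action A n S \<omega> (history A n S \<omega> r)) u])"

text \<open>Rounds are numbered from 0.\<close>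

definition solved_in_round ::
  "('c, 'm) algorithm \<Rightarrow> nat \<Rightarrow> nat set \<Rightarrow> (nat \<Rightarrow> 'c) \<Rightarrow> nat \<Rightarrow> bool"
where
  "solved_in_round A n S \<omega> r \<longleftrightarrow>
     (\<exists>!u. u \<in> S \<and> transmits (node_action A n S \<omega> (history A n S \<omega> r) u))"

definition solved_within ::
  "('c, 'm) algorithm \<Rightarrow> nat \<Rightarrow> nat set \<Rightarrow> (nat \<Rightarrow> 'c) \<Rightarrow> nat \<Rightarrow> bool"
where
  "solved_within A n S \<omega> t \<longleftrightarrow> (\<exists>r<t. solved_in_round A n S \<omega> r)"

text \<open>The random sources of the different nodes are independent.\<close>

definition joint_coins :: "('c, 'm) algorithm \<Rightarrow> nat \<Rightarrow> (nat \<Rightarrow> 'c) measure" where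
  "joint_coins A n = PiM {1..n} (coins A n)"

definition solves_wakeup_whp :: "('c, 'm) algorithm \<Rightarrow> (nat \<Rightarrow> nat) \<Rightarrow> bool" where
  "solves_wakeup_whp A f \<longleftrightarrow>
     (\<forall>n\<ge>1. \<forall>S. S \<subseteq> {1..n} \<and> S \<noteq> {} \<longrightarrow>
        measure (joint_coins A n) {\<omega> \<in> space (joint_coins A n). solved_within A n S \<omega> (f n)}
          \<ge> 1 - 1 / real n)"

end

theory Submission
  imports Defs
begin

text \<open>Activate only two nodes. As long as the problem is unsolved, both transmit or both listen, so
  after \<open>t\<close> rounds the unsolved executions are described by one of \<open>2 ^ t\<close> binary patterns, and in
  isolation each node \<open>u\<close> induces a probability distribution \<open>P u\<close> on these patterns. Nodes \<open>u\<close> and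
  \<open>v\<close> fail with probability at least the inner product of \<open>P u\<close> and \<open>P v\<close>. By Cauchy--Schwarz the
  squared norm of the sum of the \<open>P u\<close> is at least \<open>n\<^sup>2 / 2 ^ t\<close>, while its \<open>n\<close> diagonal
  terms are at most \<open>1\<close>; if all off-diagonal terms are at most \<open>1 / n\<close>, then \<open>n < 2 ^ (t + 1)\<close>.\<close>

section \<open>Executions with two active nodes\<close>

text \<open>As long as two active nodes choose alike, neither ever transmits alone or receives a
  message, so the own choice of a node determines its feedback.\<close>

definition pair_feedback :: "bool \<Rightarrow> 'm feedback" where
  "pair_feedback b = (if b then SentTogether else Silence)"

text \<open>The transmissions of a node whose partner has always made the same choice as itself.\<close>

primrec pattern :: "('m feedback list \<Rightarrow> 'm action) \<Rightarrow> nat \<Rightarrow> bool list" where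
  "pattern d 0 = []"
| "pattern d (Suc r) = pattern d r @ [transmits (d (map pair_feedback (pattern d r)))]"

lemma length_pattern [simp]: "length (pattern d r) = r"
  by (induction r) auto

lemma take_pattern: "r \<le> t \<Longrightarrow> take r (pattern d t) = pattern d r"
  by (induction t) (auto simp: le_Suc_eq)

lemma pattern_eq_mono: "pattern d t = pattern e t \<Longrightarrow> r \<le> t \<Longrightarrow> pattern d r = pattern e r"
  by (metis take_pattern)

lemma feedback_of_pair:
  assumes "u \<in> {1..n}" "v \<in> {1..n}" "u \<noteq> v"
    and "transmits (a u) = transmits (a v)"
    and "\<And>w. w \<noteq> u \<Longrightarrow> w \<noteq> v \<Longrightarrow> a w = Listen"
  shows "feedback_of n a u = pair_feedback (transmits (a u))"
proof (cases "transmits (a u)")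
  case True
  with assms have "v \<in> {w \<in> neighbors n u. transmits (a w)}"
    by (auto simp: neighbors_def)
  with True show ?thesis
    by (auto simp: feedback_of_def pair_feedback_def Let_def)
next
  case False
  with assms have "{w \<in> neighbors n u. transmits (a w)} = {}"
    by (auto simp: neighbors_def)
  with False show ?thesis
    by (auto simp: feedback_of_def pair_feedback_def Let_def)
qed

text \<open>The assumption built into \<open>pattern\<close> comes true when the two patterns agree:
  if the histories are as predicted up to some round, the next actions are the next pattern entries,
  which coincide, so the feedback is again as predicted.\<close>

lemma history_pair:
  assumes uv: "u \<in> {1..n}" "v \<in> {1..n}" "u \<noteq> v"
    and eq: "pattern (act A n u (\<omega> u)) t = pattern (act A n v (\<omega> v)) t"
    and "r \<le> t"
  shows "history A n {u, v} \<omega> r u = map pair_feedback (pattern (act A n u (\<omega> u)) r) \<and>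
    history A n {u, v} \<omega> r v = map pair_feedback (pattern (act A n v (\<omega> v)) r)"
  using \<open>r \<le> t\<close>
proof (induction r)
  case 0
  then show ?case by simp
next
  case (Suc r)
  let ?a = "node_action A n {u, v} \<omega> (history A n {u, v} \<omega> r)"
  have a: "?a u = act A n u (\<omega> u) (map pair_feedback (pattern (act A n u (\<omega> u)) r))"
    "?a v = act A n v (\<omega> v) (map pair_feedback (pattern (act A n v (\<omega> v)) r))"
    using Suc by (auto simp: node_action_def)
  have same: "transmits (?a u) = transmits (?a v)"
    using pattern_eq_mono[OF eq Suc.prems] unfolding a by auto
  have other: "?a w = Listen" if "w \<noteq> u" "w \<noteq> v" for w
    using that by (simp add: node_action_def)
  have "feedback_of n ?a u = pair_feedback (transmits (?a u))"
    using uv same other by (intro feedback_of_pair) auto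
  moreover have "feedback_of n ?a v = pair_feedback (transmits (?a v))"
    using uv same other by (intro feedback_of_pair[where v = u]) auto
  ultimately show ?case
    using Suc by (simp add: a)
qed

lemma not_solved_within_pair:
  assumes uv: "u \<in> {1..n}" "v \<in> {1..n}" "u \<noteq> v"
    and eq: "pattern (act A n u (\<omega> u)) t = pattern (act A n v (\<omega> v)) t"
  shows "\<not> solved_within A n {u, v} \<omega> t"
proof -
  have "\<not> solved_in_round A n {u, v} \<omega> r" if "r < t" for r
  proof -
    let ?a = "node_action A n {u, v} \<omega> (history A n {u, v} \<omega> r)"
    have "transmits (?a u) = transmits (?a v)"
      \<comment> \<open>The decision in round \<open>r\<close> is the last entry of the prefix of
        length \<open>Suc r\<close>.\<close>
      using history_pair[OF uv eq, of r] pattern_eq_mono[OF eq, of "Suc r"] that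
      by (auto simp: node_action_def)
    then show ?thesis
      using \<open>u \<noteq> v\<close> unfolding solved_in_round_def by auto
  qed
  then show ?thesis
    by (auto simp: solved_within_def)
qed

section \<open>Measurability of pattern events and independence of nodes\<close>

text \<open>Once \<open>butlast b\<close> is fixed, so is the history before the last decision;
  hence each further entry only intersects with one transmission event or its complement.\<close>

lemma sets_pattern_eq:
  assumes "\<And>h. {c \<in> space M. transmits (D c h)} \<in> sets M"
  shows "{c \<in> space M. pattern (D c) t = b} \<in> sets M"
proof (induction t arbitrary: b)
  case 0
  then show ?case by (cases "b = []") auto
next
  case (Suc t)
  let ?T = "{c \<in> space M. transmits (D c (map pair_feedback (butlast b)))}"
  have "{c \<in> space M. pattern (D c) (Suc t) = b} =
    (if b = [] then {} else
      {c \<in> space M. pattern (D c) t = butlast b} \<inter> (if last b then ?T else space M - ?T))"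
    by (cases b rule: rev_cases) auto
  moreover have "\<dots> \<in> sets M"
    using Suc assms by auto
  ultimately show ?case by simp
qed

lemma sum_prob_pattern_eq:
  assumes "prob_space M" and "\<And>h. {c \<in> space M. transmits (D c h)} \<in> sets M"
  shows "(\<Sum>b | length b = t. measure M {c \<in> space M. pattern (D c) t = b}) = 1"
proof -
  interpret prob_space M by fact
  have "finite {b :: bool list. length b = t}"
    using finite_lists_length_eq[of "UNIV :: bool set" t] by simp
  then have "prob (\<Union>b\<in>{b. length b = t}. {c \<in> space M. pattern (D c) t = b}) =
    (\<Sum>b | length b = t. prob {c \<in> space M. pattern (D c) t = b})"
    using sets_pattern_eq[of M D, OF assms(2)]
    by (intro finite_measure_finite_Union) (auto simp: disjoint_family_on_def)
  moreover have "(\<Union>b\<in>{b. length b = t}. {c \<in> space M. pattern (D c) t = b}) = space M"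
    by auto
  ultimately show ?thesis
    by (simp add: prob_space)
qed

text \<open>The library requires \<open>M i\<close> to be a probability space for every \<open>i\<close>, even outside \<open>I\<close>;
  there the factors are replaced by a point mass.\<close>

lemma prob_space_PiM_on:
  assumes "\<And>i. i \<in> I \<Longrightarrow> prob_space (M i)"
  shows "prob_space (PiM I M)"
proof -
  define N where "N i = (if i \<in> I then M i else return (count_space UNIV) undefined)" for i
  have "prob_space (PiM I N)"
    by (intro prob_space_PiM) (auto simp: N_def assms intro!: prob_space_return)
  moreover have "PiM I N = PiM I M"
    by (intro PiM_cong) (auto simp: N_def)
  ultimately show ?thesis by simp
qed

text \<open>The event is a box whose sides other than \<open>X\<close> and \<open>Y\<close> are
  whole spaces and contribute factors 1.\<close>

lemma measure_PiM_pair: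
  assumes I: "finite I" "u \<in> I" "v \<in> I" "u \<noteq> v"
    and M: "\<And>i. i \<in> I \<Longrightarrow> prob_space (M i)"
    and XY: "X \<in> sets (M u)" "Y \<in> sets (M v)"
  shows "{\<omega> \<in> space (PiM I M). \<omega> u \<in> X \<and> \<omega> v \<in> Y} \<in> sets (PiM I M)"
    and "measure (PiM I M) {\<omega> \<in> space (PiM I M). \<omega> u \<in> X \<and> \<omega> v \<in> Y} =
      measure (M u) X * measure (M v) Y"
proof -
  define N where "N i = (if i \<in> I then M i else return (count_space UNIV) undefined)" for i
  have N: "prob_space (N i)" for i
    by (auto simp: N_def M intro!: prob_space_return)
  interpret N: finite_product_prob_space N I
    by (intro finite_product_prob_space.intro finite_product_sigma_finite.intro
        finite_product_sigma_finite_axioms.intro product_sigma_finite.intro product_prob_spaceI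
        prob_space_imp_sigma_finite N I)
  have MN: "PiM I M = PiM I N"
    by (intro PiM_cong) (auto simp: N_def)
  define Z where "Z i = (if i = u then X else if i = v then Y else space (M i))" for i
  have Z: "Z i \<in> sets (N i)" if "i \<in> I" for i
    using that I XY by (auto simp: Z_def N_def)
  have "X \<subseteq> space (M u)" "Y \<subseteq> space (M v)"
    using XY by (auto dest: sets.sets_into_space)
  then have "\<omega> \<in> space (PiM I M) \<and> \<omega> u \<in> X \<and> \<omega> v \<in> Y \<longleftrightarrow> \<omega> \<in> Pi\<^sub>E I Z" for \<omega>
    using I unfolding space_PiM PiE_iff Z_def by (smt (verit) subsetD)
  then have "{\<omega> \<in> space (PiM I M). \<omega> u \<in> X \<and> \<omega> v \<in> Y} = Pi\<^sub>E I Z"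
    by blast
  moreover have "Pi\<^sub>E I Z \<in> sets (PiM I N)"
    using I Z by (intro sets_PiM_I_finite) auto
  moreover have "measure (PiM I N) (Pi\<^sub>E I Z) = measure (M u) X * measure (M v) Y"
  proof -
    have "measure (PiM I N) (Pi\<^sub>E I Z) = (\<Prod>i\<in>I. measure (N i) (Z i))"
      using Z by (intro N.prob_times) auto
    also have "\<dots> = (\<Prod>i\<in>{u, v}. measure (N i) (Z i))"
      using I M by (intro prod.mono_neutral_right) (auto simp: N_def Z_def prob_space.prob_space)
    finally show ?thesis
      using I by (auto simp: N_def Z_def)
  qed
  ultimately show "{\<omega> \<in> space (PiM I M). \<omega> u \<in> X \<and> \<omega> v \<in> Y} \<in> sets (PiM I M)"
    and "measure (PiM I M) {\<omega> \<in> space (PiM I M). \<omega> u \<in> X \<and> \<omega> v \<in> Y} =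
      measure (M u) X * measure (M v) Y"
    by (simp_all add: MN)
qed

section \<open>Inner products of probability vectors\<close>

text \<open>Cauchy--Schwarz for the sum of the vectors \<open>P u\<close> against the all-ones
  vector on \<open>B\<close>: their inner product is the total mass \<open>card I\<close>.\<close>

lemma card_sq_le_sum_inner_products:
  fixes P :: "'a \<Rightarrow> 'b \<Rightarrow> real"
  assumes "finite B" and "\<And>u. u \<in> I \<Longrightarrow> (\<Sum>b\<in>B. P u b) = 1"
  shows "(real (card I))\<^sup>2 \<le> real (card B) * (\<Sum>u\<in>I. \<Sum>v\<in>I. \<Sum>b\<in>B. P u b * P v b)"
proof -
  have "real (card I) = (\<Sum>b\<in>B. \<Sum>u\<in>I. P u b)"
    by (subst sum.swap) (simp add: assms)
  then have "(real (card I))\<^sup>2 \<le> real (card B) * (\<Sum>b\<in>B. (\<Sum>u\<in>I. P u b)\<^sup>2)"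
    using sum_squared_le_sum_of_squares[of "\<lambda>b. \<Sum>u\<in>I. P u b" B]
    by (simp add: mult.commute)
  also have "(\<Sum>b\<in>B. (\<Sum>u\<in>I. P u b)\<^sup>2) = (\<Sum>u\<in>I. \<Sum>v\<in>I. \<Sum>b\<in>B. P u b * P v b)"
    unfolding power2_eq_square sum_product
    by (subst sum.swap, rule sum.cong[OF refl], subst sum.swap, rule refl)
  finally show ?thesis .
qed

text \<open>Needed for the diagonal terms, to which the failure bound for two distinct nodes does
  not apply.\<close>

lemma sum_sq_le_one:
  fixes p :: "'b \<Rightarrow> real"
  assumes "finite B" "\<And>b. b \<in> B \<Longrightarrow> 0 \<le> p b" "(\<Sum>b\<in>B. p b) = 1"
  shows "(\<Sum>b\<in>B. p b * p b) \<le> 1"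
proof -
  have "p b \<le> 1" if "b \<in> B" for b
    using member_le_sum[of b B p] assms that by auto
  then have "(\<Sum>b\<in>B. p b * p b) \<le> (\<Sum>b\<in>B. p b)"
    using assms by (intro sum_mono mult_left_le) auto
  then show ?thesis using assms by simp
qed

section \<open>From failure probabilities to the lower bound\<close>

text \<open>The events that both patterns equal \<open>b\<close> are disjoint for different
  \<open>b\<close>, have product probabilities by independence, and lie in the failure event of the
  active set \<open>{u, v}\<close>.\<close>

lemma pair_failure_le:
  fixes A :: "('c, 'm) algorithm"
  assumes A: "randomized_algorithm A" and f: "solves_wakeup_whp A f"
    and uv: "u \<in> {1..n}" "v \<in> {1..n}" "u \<noteq> v"
  defines "P \<equiv> \<lambda>u b. measure (coins A n u) {c \<in> space (coins A n u). pattern (act A n u c) (f n) = b}"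
  shows "(\<Sum>b | length b = f n. P u b * P v b) \<le> 1 / real n"
proof -
  let ?J = "joint_coins A n"
  let ?solved = "{\<omega> \<in> space ?J. solved_within A n {u, v} \<omega> (f n)}"
  define X where "X u b = {c \<in> space (coins A n u). pattern (act A n u c) (f n) = b}" for u b
  define E where "E b = {\<omega> \<in> space ?J. \<omega> u \<in> X u b \<and> \<omega> v \<in> X v b}" for b
  have coins: "prob_space (coins A n i)" if "i \<in> {1..n}" for i
    using A that by (auto simp: randomized_algorithm_def)
  have X: "X i b \<in> sets (coins A n i)" if "i \<in> {1..n}" for i b
    unfolding X_def using A that by (intro sets_pattern_eq) (auto simp: randomized_algorithm_def)
  interpret prob_space ?J
    unfolding joint_coins_def by (intro prob_space_PiM_on coins)
  have E: "E b \<in> events" "prob (E b) = P u b * P v b" for b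
    using measure_PiM_pair[of "{1..n}" u v "coins A n", OF _ uv coins X[OF uv(1)] X[OF uv(2)]]
    by (auto simp: E_def P_def X_def joint_coins_def)
  have ge: "prob ?solved \<ge> 1 - 1 / real n"
    using f uv by (auto simp: solves_wakeup_whp_def)
  \<comment> \<open>Measurability of \<open>?solved\<close> is not assumed. It follows because
    non-measurable sets get measure 0, whereas the success bound is positive for
    \<open>n \<ge> 2\<close>.\<close>
  have "n \<ge> 2"
    using uv by auto
  then have "1 - 1 / real n > 0"
    by simp
  with ge have meas: "?solved \<in> events"
    by (metis measure_notin_sets not_le)
  have fin: "finite {b :: bool list. length b = f n}"
    using finite_lists_length_eq[of "UNIV :: bool set" "f n"] by simp
  have "(\<Sum>b | length b = f n. P u b * P v b) = prob (\<Union>b\<in>{b. length b = f n}. E b)"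
    unfolding E(2)[symmetric] using fin E(1)
    by (intro finite_measure_finite_Union[symmetric])
      (auto simp: disjoint_family_on_def E_def X_def)
  also have "\<dots> \<le> prob (space ?J - ?solved)"
  proof (rule finite_measure_mono)
    show "(\<Union>b\<in>{b. length b = f n}. E b) \<subseteq> space ?J - ?solved"
      using not_solved_within_pair[OF uv, of A _ "f n"] by (fastforce simp: E_def X_def)
  qed (use meas in auto)
  also have "\<dots> \<le> 1 / real n"
    using prob_compl[OF meas] ge by simp
  finally show ?thesis .
qed

lemma less_two_power_rounds:
  fixes A :: "('c, 'm) algorithm"
  assumes A: "randomized_algorithm A" and f: "solves_wakeup_whp A f" and "n \<ge> 1"
  shows "real n < 2 ^ (f n + 1)"
proof -
  define P where
    "P u b = measure (coins A n u) {c \<in> space (coins A n u). pattern (act A n u c) (f n) = b}" for u b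
  let ?B = "{b :: bool list. length b = f n}"
  have fin: "finite ?B" and card: "card ?B = 2 ^ f n"
    using finite_lists_length_eq[of "UNIV :: bool set" "f n"]
      card_lists_length_eq[of "UNIV :: bool set" "f n"] by simp_all
  have P1: "(\<Sum>b\<in>?B. P u b) = 1" if "u \<in> {1..n}" for u
    unfolding P_def using A that
    by (intro sum_prob_pattern_eq) (auto simp: randomized_algorithm_def)
  have inner: "(\<Sum>b\<in>?B. P u b * P v b) \<le> (if u = v then 1 else 1 / real n)"
    if "u \<in> {1..n}" "v \<in> {1..n}" for u v
  proof (cases "u = v")
    case True
    then show ?thesis
      using sum_sq_le_one[OF fin, of "P u"] P1 that by (auto simp: P_def)
  next
    case False
    then show ?thesis
      using pair_failure_le[OF A f that] by (simp add: P_def)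
  qed
  have "(real n)\<^sup>2 \<le> 2 ^ f n * (\<Sum>u\<in>{1..n}. \<Sum>v\<in>{1..n}. \<Sum>b\<in>?B. P u b * P v b)"
    using card_sq_le_sum_inner_products[OF fin P1, of "{1..n}"] by (simp add: card)
  also have "\<dots> \<le> 2 ^ f n * (\<Sum>u\<in>{1..n}. \<Sum>v\<in>{1..n}. if u = v then 1 else 1 / real n)"
    by (intro mult_left_mono sum_mono inner) auto
  \<comment> \<open>Each of the \<open>n\<close> rows has one diagonal bound 1 and
    \<open>n - 1\<close> bounds \<open>1 / n\<close>, so the double sum is \<open>2 * n - 1\<close>;
    dropping the \<open>- 1\<close> later makes the estimate strict.\<close>
  also have "\<dots> = 2 ^ f n * (\<Sum>u\<in>{1..n}. 1 + (real n - 1) / real n)"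
  proof -
    have "(\<Sum>v\<in>{1..n}. if u = v then 1 else 1 / real n) = 1 + (real n - 1) / real n"
      if "u \<in> {1..n}" for u
      using that \<open>n \<ge> 1\<close> by (subst sum.remove[OF _ that]) (auto simp: of_nat_diff)
    then show ?thesis by simp
  qed
  also have "\<dots> = 2 ^ f n * (2 * real n - 1)"
    using \<open>n \<ge> 1\<close> by (simp add: field_simps)
  also have "\<dots> < 2 ^ f n * (2 * real n)"
    by simp
  finally have "real n * real n < 2 ^ (f n + 1) * real n"
    by (simp add: power2_eq_square algebra_simps)
  then show ?thesis
    by (simp add: mult_less_cancel_right)
qed

theorem theorem6p1:
  fixes A :: "('c, 'm) algorithm" and f :: "nat \<Rightarrow> nat"
  assumes "randomized_algorithm A"
    and "solves_wakeup_whp A f"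
  shows "(\<lambda>n. real (f n)) \<in> \<Omega>(\<lambda>n. log 2 (real n))"
proof (rule landau_omega.bigI[of "1 / 2"])
  show "\<forall>\<^sub>F n in sequentially. norm (real (f n)) \<ge> 1 / 2 * norm (log 2 (real n))"
    using eventually_ge_at_top[of 4]
  proof eventually_elim
    case (elim n)
    have "log 2 (real n) < real (f n + 1)"
      using less_two_power_rounds[OF assms, of n] elim by (intro log_of_power_less) auto
    \<comment> \<open>For \<open>n \<ge> 4\<close> the additive loss of 1 in
      \<open>log 2 n < f n + 1\<close> is at most half of \<open>log 2 n\<close>, which gives the
      constant \<open>1 / 2\<close>.\<close>
    moreover have "real 2 \<le> log 2 (real n)"
      using elim by (intro le_log_of_power) auto
    ultimately show ?case by simp
  qed
qed simp

end
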